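(* Let $D=\{(x,y)\in\mathbb{R}^2: x^2+y^2<1\}$ be the open unit disc. For each non-empty closed subset $Z$ of the critical locus $\mathcal{L}(D)$, there exists a bounded convex symmetric domain $K\subset\mathbb{R}^2$ with $K\supset D$ such that $\mathcal{L}(K)=Z$.
   Context: A domain in $\mathbb{R}^2$ is a non-empty connected open set; a domain $K$ is symmetric if $K=-K$ (symmetric about the origin). A lattice in $\mathbb{R}^2$ is a set of the form $\Lambda=g\mathbb{Z}^2$ with $g\in\operatorname{GL}_2(\mathbb{R})$; its covolume is $d(\Lambda)=|\det g|$, which is independent of the choice of $g$. The space $X_2$ of all lattices in $\mathbb{R}^2$ is identified with $\operatorname{GL}_2(\mathbb{R})/\operatorname{GL}_2(\mathbb{Z})$ and carries the quotient topology. Let $K$ be a bounded convex symmetric domain in $\mathbb{R}^2$. A lattice $\Lambda$ is $K$-admissible if $\Lambda\cap K=\{0\}$. The critical determinant of $K$ is $\Delta(K)=\inf\{d(\Lambda):\Lambda \text{ is } K\text{-admissible}\}$. A lattice is $K$-critical if it is $K$-admissible and $d(\Lambda)=\Delta(K)$. The critical locus $\mathcal{L}(K)\subset X_2$ is the set of all $K$-critical lattices, with the subspace topology; closed subsets of $\mathcal{L}(D)$ are taken with respect to this topology. *)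

theory Defs
  imports "HOL-Analysis.Analysis"
begin

definition integer_points :: "(real^2) set" where
  "integer_points = {v. \<forall>i. v $ i \<in> \<int>}"

definition lattice_of :: "real^2^2 \<Rightarrow> (real^2) set" where
  "lattice_of g = (\<lambda>v. g *v v) ` integer_points"

definition GL2 :: "(real^2^2) set" where
  "GL2 = {g. invertible g}"

definition GL2Z :: "(real^2^2) set" where
  "GL2Z = {u. (\<forall>i j. u $ i $ j \<in> \<int>) \<and> \<bar>det u\<bar> = 1}"

definition lattices :: "(real^2) set set" where
  "lattices = lattice_of ` GL2"

text \<open>A lattice is the point set \<open>g \<int>\<^sup>2\<close>, which stands for the coset \<open>g GL\<^sub>2(\<int>)\<close>
  (see \<open>lattice_of_eq_iff\<close>).  The space of lattices carries the quotient topology along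
  \<open>g \<mapsto> g \<int>\<^sup>2\<close> (see \<open>quotient_map_lattice_of\<close>).\<close>

definition lattice_space :: "(real^2) set topology" where
  "lattice_space = topology (\<lambda>U. U \<subseteq> lattices \<and>
     openin (top_of_set GL2) {g \<in> GL2. lattice_of g \<in> U})"

text \<open>The description is unique by \<open>covolume_lattice_of\<close> below.\<close>

definition covolume :: "(real^2) set \<Rightarrow> real" where
  "covolume \<Lambda> = (THE d. \<exists>g\<in>GL2. \<Lambda> = lattice_of g \<and> d = \<bar>det g\<bar>)"

definition admissible :: "(real^2) set \<Rightarrow> (real^2) set \<Rightarrow> bool" where
  "admissible K \<Lambda> \<longleftrightarrow> \<Lambda> \<in> lattices \<and> \<Lambda> \<inter> K = {0}"

text \<open>The infimum is that of a set of nonnegative reals, nonempty for bounded \<open>K\<close> containing the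
  origin.\<close>

definition critical_det :: "(real^2) set \<Rightarrow> real" where
  "critical_det K = Inf {covolume \<Lambda> | \<Lambda>. admissible K \<Lambda>}"

definition critical :: "(real^2) set \<Rightarrow> (real^2) set \<Rightarrow> bool" where
  "critical K \<Lambda> \<longleftrightarrow> admissible K \<Lambda> \<and> covolume \<Lambda> = critical_det K"

definition critical_locus :: "(real^2) set \<Rightarrow> (real^2) set set" where
  "critical_locus K = {\<Lambda>. critical K \<Lambda>}"

definition planar_domain :: "(real^2) set \<Rightarrow> bool" where
  "planar_domain K \<longleftrightarrow> open K \<and> connected K \<and> K \<noteq> {}"

definition symmetric_set :: "(real^2) set \<Rightarrow> bool" where
  "symmetric_set K \<longleftrightarrow> K = uminus ` K"

definition unit_disc :: "(real^2) set" where
  "unit_disc = {v. (v $ 1)\<^sup>2 + (v $ 2)\<^sup>2 < 1}"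


lemma quotient_map_lattice_of:
  "quotient_map (top_of_set GL2) lattice_space lattice_of"
proof -
  let ?P = "\<lambda>U. U \<subseteq> lattices \<and> openin (top_of_set GL2) {g \<in> GL2. lattice_of g \<in> U}"
  have "istopology ?P"
    unfolding istopology_def
  proof (intro conjI allI impI)
    fix S T assume S: "?P S" and T: "?P T"
    have eq: "{g \<in> GL2. lattice_of g \<in> S \<inter> T} =
      {g \<in> GL2. lattice_of g \<in> S} \<inter> {g \<in> GL2. lattice_of g \<in> T}" by auto
    show "S \<inter> T \<subseteq> lattices" using S by auto
    show "openin (top_of_set GL2) {g \<in> GL2. lattice_of g \<in> S \<inter> T}"
      unfolding eq using S T by (intro openin_Int) auto
  next
    fix \<K> assume K: "\<forall>U\<in>\<K>. ?P U"
    have eq: "{g \<in> GL2. lattice_of g \<in> \<Union>\<K>} = (\<Union>U\<in>\<K>. {g \<in> GL2. lattice_of g \<in> U})" by auto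
    show "\<Union>\<K> \<subseteq> lattices" using K by auto
    show "openin (top_of_set GL2) {g \<in> GL2. lattice_of g \<in> \<Union>\<K>}"
      unfolding eq using K by (intro openin_Union) auto
  qed
  then have o: "openin lattice_space U \<longleftrightarrow> ?P U" for U
    unfolding lattice_space_def by (simp add: topology_inverse')
  have "{g \<in> GL2. lattice_of g \<in> lattices} = GL2"
    unfolding lattices_def by auto
  then have "openin lattice_space lattices"
    unfolding o using openin_subtopology_self by auto
  then have ts: "topspace lattice_space = lattices"
    using o openin_subset openin_topspace by blast
  show ?thesis
    unfolding quotient_map_def ts by (auto simp: o lattices_def)
qed

lemma integer_points_axis: "axis j 1 \<in> integer_points"
  by (auto simp: integer_points_def axis_def)

lemma integer_points_mult:
  assumes "\<And>i j. u $ i $ j \<in> \<int>" "v \<in> integer_points"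
  shows "(u::real^2^2) *v v \<in> integer_points"
  using assms by (auto simp: integer_points_def matrix_vector_mult_def intro!: Ints_sum Ints_mult)

lemma det_Ints: "(\<And>i j. u $ i $ j \<in> \<int>) \<Longrightarrow> det (u::real^2^2) \<in> \<int>"
  by (auto simp: det_2)

lemma lattice_of_subset_imp:
  assumes g: "g \<in> GL2" and sub: "lattice_of h \<subseteq> lattice_of g"
  obtains u where "h = g ** u" "\<And>i j. u $ i $ j \<in> \<int>"
proof -
  obtain g' where g': "g' ** g = mat 1" "g ** g' = mat 1"
    using g by (auto simp: GL2_def invertible_def)
  define u where "u = g' ** h"
  have h: "h = g ** u"
    by (simp add: u_def matrix_mul_assoc g')
  have "u $ i $ j \<in> \<int>" for i j
  proof -
    have "h *v axis j 1 \<in> lattice_of g"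
      using sub integer_points_axis by (auto simp: lattice_of_def)
    then obtain w where w: "w \<in> integer_points" "h *v axis j 1 = g *v w"
      by (auto simp: lattice_of_def)
    have "u *v axis j 1 = w"
      by (simp add: u_def w(2) matrix_vector_mul_assoc [symmetric])
         (simp add: matrix_vector_mul_assoc g')
    then have "u $ i $ j = w $ i"
      by (metis column_def matrix_vector_mult_basis vec_lambda_beta)
    then show ?thesis using w(1) by (auto simp: integer_points_def)
  qed
  then show thesis using h that by blast
qed

lemma lattice_of_eq_iff:
  assumes g: "g \<in> GL2" and h: "h \<in> GL2"
  shows "lattice_of g = lattice_of h \<longleftrightarrow> (\<exists>u\<in>GL2Z. h = g ** u)"
proof
  assume eq: "lattice_of g = lattice_of h"
  obtain u where u: "h = g ** u" "\<And>i j. u $ i $ j \<in> \<int>"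
    using lattice_of_subset_imp [OF g] eq by blast
  obtain v where v: "g = h ** v" "\<And>i j. v $ i $ j \<in> \<int>"
    using lattice_of_subset_imp [OF h] eq by blast
  have "det h = det h * (det v * det u)"
    by (metis u(1) v(1) det_mul mult.assoc)
  moreover have "det h \<noteq> 0" using h by (simp add: GL2_def invertible_det_nz)
  ultimately have "det v * det u = 1" by simp
  moreover obtain a b where "det u = of_int a" "det v = of_int b"
    using det_Ints u(2) v(2) by (metis Ints_cases)
  ultimately have "of_int (b * a) = (1::real)" "det u = of_int a" by simp_all
  then have "b * a = 1" by linarith
  then have "\<bar>a\<bar> = 1" by (metis abs_zmult_eq_1 mult.commute abs_one)
  then have "\<bar>det u\<bar> = 1" using \<open>det u = of_int a\<close> by linarith
  then show "\<exists>u\<in>GL2Z. h = g ** u" using u by (auto simp: GL2Z_def)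
next
  assume "\<exists>u\<in>GL2Z. h = g ** u"
  then obtain u where u: "\<And>i j. u $ i $ j \<in> \<int>" "\<bar>det u\<bar> = 1" "h = g ** u"
    by (auto simp: GL2Z_def)
  have d: "det u = 1 \<or> det u = -1" using u(2) by linarith
  define v :: "real^2^2" where
    "v = vector [vector [u$2$2 / det u, - u$1$2 / det u], vector [- u$2$1 / det u, u$1$1 / det u]]"
  have vZ: "v $ i $ j \<in> \<int>" for i j
    using d u(1) exhaust_2[of i] exhaust_2[of j] by (auto simp: v_def)
  have uv: "u ** v = mat 1"
  proof -
    have "det u / det u = 1" using d by auto
    then have "u$1$1 * (u$2$2 / det u) - u$1$2 * (u$2$1 / det u) = 1"
      by (metis det_2 diff_divide_distrib times_divide_eq_right)
    then show ?thesis
      by (auto simp: v_def vec_eq_iff forall_2 matrix_matrix_mult_def sum_2 mat_def algebra_simps)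
  qed
  have "lattice_of h \<subseteq> lattice_of g"
    using integer_points_mult [OF u(1)]
    by (auto simp: lattice_of_def u(3) matrix_vector_mul_assoc [symmetric])
  moreover have "g *v w \<in> lattice_of h" if "w \<in> integer_points" for w
  proof -
    have "g *v w = h *v (v *v w)"
      by (simp add: u(3) matrix_vector_mul_assoc matrix_mul_assoc [symmetric] uv)
    then show ?thesis
      using integer_points_mult [OF vZ that] by (auto simp: lattice_of_def)
  qed
  ultimately show "lattice_of g = lattice_of h" by (auto simp: lattice_of_def)
qed

lemma covolume_lattice_of:
  assumes "g \<in> GL2"
  shows "covolume (lattice_of g) = \<bar>det g\<bar>"
  unfolding covolume_def
proof (rule the_equality)
  show "\<exists>h\<in>GL2. lattice_of g = lattice_of h \<and> \<bar>det g\<bar> = \<bar>det h\<bar>" using assms by auto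
next
  fix d assume "\<exists>h\<in>GL2. lattice_of g = lattice_of h \<and> d = \<bar>det h\<bar>"
  then obtain h where h: "h \<in> GL2" "lattice_of g = lattice_of h" "d = \<bar>det h\<bar>" by auto
  then obtain u where "u \<in> GL2Z" "h = g ** u" using lattice_of_eq_iff assms by blast
  then show "d = \<bar>det g\<bar>" by (simp add: h(3) det_mul abs_mult GL2Z_def)
qed

end

theory Submission
  imports Defs
begin

text \<open>By Gauss reduction, the critical lattices of the unit disc are the hexagonal lattices
  generated by a unit vector \<open>w\<close> and its rotation by \<open>60\<close> degrees; their covolume is
  \<open>sqrt 3 / 2\<close> (\<open>covolume_admissible_unit_disc\<close>, \<open>critical_locus_unit_disc\<close>). Such a lattice is
  determined by any one of its six unit vectors (\<open>hex_lattice_eqI\<close>), and its other nonzero vectors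
  have squared length at least \<open>2\<close> (\<open>hex_lattice_norm_ge\<close>).

  Given \<open>Z\<close>, let \<open>S\<close> be the set of all unit vectors that lie in some lattice of \<open>Z\<close>, and let
  \<open>K\<close> be the intersection of the open half-planes \<open>x \<bullet> s < 1\<close> over \<open>s \<in> S\<close>. This set contains the
  disc, and the tangent lines touch the unit circle exactly in \<open>S\<close>: a unit vector lies outside
  \<open>K\<close> if and only if it belongs to \<open>S\<close>. The six unit vectors of a single lattice of \<open>Z\<close> already
  confine \<open>K\<close> to a regular hexagon of squared circumradius \<open>4 / 3 < 2\<close> (\<open>hexagon_inner_less\<close>), so
  that only the unit vectors of a hexagonal lattice decide whether it is \<open>K\<close>-admissible. It is
  admissible if they lie in \<open>S\<close>, that is, if the lattice is a member of \<open>Z\<close>. As \<open>K\<close> contains the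
  disc, and the hexagonal lattices in \<open>Z\<close> are still admissible, the critical determinant does not
  change, and the critical lattices of \<open>K\<close> are those of the disc that are \<open>K\<close>-admissible
  (\<open>critical_det_disc_superset\<close>).

  The closedness of \<open>Z\<close> enters through the openness of \<open>K\<close>: as \<open>w\<close> determines its hexagonal
  lattice continuously, \<open>S\<close> is the preimage of a closed set in the circle, hence compact.\<close>

section \<open>Lattices with a given basis\<close>

text \<open>The matrix with columns \<open>a\<close> and \<open>b\<close>.\<close>

definition frame :: "real^2 \<Rightarrow> real^2 \<Rightarrow> real^2^2" where
  "frame a b = vector [vector [a $ 1, b $ 1], vector [a $ 2, b $ 2]]"

lemma frame_mult: "frame a b *v p = p $ 1 *\<^sub>R a + p $ 2 *\<^sub>R b"
  by (simp add: frame_def vec_eq_iff forall_2 matrix_vector_mult_def sum_2 mult.commute)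

lemma det_frame: "det (frame a b) = a $ 1 * b $ 2 - b $ 1 * a $ 2"
  by (simp add: frame_def det_2)

lemma frame_columns: "(g::real^2^2) = frame (column 1 g) (column 2 g)"
  by (simp add: frame_def vec_eq_iff forall_2 column_def)

lemma frame_in_GL2_iff: "frame a b \<in> GL2 \<longleftrightarrow> det (frame a b) \<noteq> 0"
  by (simp add: GL2_def invertible_det_nz)

lemma inner_real2: "(a::real^2) \<bullet> b = a $ 1 * b $ 1 + a $ 2 * b $ 2"
  by (simp add: inner_vec_def sum_2)

lemma lattice_of_frame:
  "lattice_of (frame a b) = {of_int m *\<^sub>R a + of_int n *\<^sub>R b | m n. True}"
proof -
  have "of_int m *\<^sub>R a + of_int n *\<^sub>R b \<in> lattice_of (frame a b)" for m n
  proof -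
    have "vector [of_int m, of_int n] \<in> integer_points"
      by (simp add: integer_points_def forall_2)
    moreover have "frame a b *v vector [of_int m, of_int n] = of_int m *\<^sub>R a + of_int n *\<^sub>R b"
      by (simp add: frame_mult)
    ultimately show ?thesis
      unfolding lattice_of_def by (metis imageI)
  qed
  moreover have "\<exists>m n. frame a b *v p = of_int m *\<^sub>R a + of_int n *\<^sub>R b"
    if "p \<in> integer_points" for p
    using that by (metis (mono_tags, lifting) Ints_cases frame_mult integer_points_def mem_Collect_eq)
  ultimately show ?thesis
    by (auto simp: lattice_of_def)
qed

lemma mem_lattice_of_frame: "a \<in> lattice_of (frame a b)"
proof -
  have "a = of_int 1 *\<^sub>R a + of_int 0 *\<^sub>R b" by simp
  then show ?thesis
    unfolding lattice_of_frame by blast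
qed

lemma lattice_of_diff:
  assumes "x \<in> lattice_of g" "y \<in> lattice_of g"
  shows "x - y \<in> lattice_of g"
proof -
  obtain p q where "p \<in> integer_points" "q \<in> integer_points" "x = g *v p" "y = g *v q"
    using assms by (auto simp: lattice_of_def)
  then have "p - q \<in> integer_points" "x - y = g *v (p - q)"
    by (auto simp: integer_points_def matrix_vector_mult_diff_distrib)
  then show ?thesis
    by (simp add: lattice_of_def)
qed

text \<open>The elementary column operations needed for reduction, the exchange of basis vectors and the
  rotation inside a hexagonal lattice are all integral substitutions of determinant \<open>\<plusminus>1\<close>.\<close>

lemma change_of_basis:
  fixes p q r s :: int
  assumes "\<bar>p * s - q * r\<bar> = 1" and F: "frame a b \<in> GL2"
    and c: "c = of_int p *\<^sub>R a + of_int q *\<^sub>R b" and d: "d = of_int r *\<^sub>R a + of_int s *\<^sub>R b"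
  shows "frame c d \<in> GL2" "lattice_of (frame c d) = lattice_of (frame a b)"
proof -
  define u :: "real^2^2" where
    "u = vector [vector [of_int p, of_int r], vector [of_int q, of_int s]]"
  have "det u = of_int (p * s - q * r)"
    by (simp add: u_def det_2)
  then have "\<bar>det u\<bar> = 1"
    using assms(1) by (metis of_int_1 of_int_abs)
  then have u: "u \<in> GL2Z"
    by (auto simp: GL2Z_def u_def forall_2)
  have eq: "frame c d = frame a b ** u"
    by (simp add: c d u_def frame_def vec_eq_iff forall_2 matrix_matrix_mult_def sum_2 algebra_simps)
  have "det (frame c d) \<noteq> 0"
    using F \<open>\<bar>det u\<bar> = 1\<close> by (auto simp: eq det_mul frame_in_GL2_iff)
  then show G: "frame c d \<in> GL2"
    by (simp add: frame_in_GL2_iff)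
  show "lattice_of (frame c d) = lattice_of (frame a b)"
    using lattice_of_eq_iff[OF F G] eq u by metis
qed

text \<open>The Gram determinant: it expresses the covolume through the lengths and the angle of a basis,
  which are the data that reduction controls.\<close>

lemma det_frame_squared: "(det (frame a b))\<^sup>2 = (a \<bullet> a) * (b \<bullet> b) - (a \<bullet> b)\<^sup>2"
  by (simp add: det_frame inner_real2 power2_eq_square algebra_simps)

section \<open>Reduction of lattices that are admissible for the disc\<close>

lemma unit_disc_eq_ball: "unit_disc = ball 0 1"
proof -
  have "v \<in> unit_disc \<longleftrightarrow> norm v < 1" for v
    by (simp add: unit_disc_def norm_eq_sqrt_inner inner_real2 power2_eq_square)
  then show ?thesis by (simp add: set_eq_iff)
qed

lemma admissible_unit_disc_norm_ge:
  assumes "admissible unit_disc \<Lambda>" "x \<in> \<Lambda>" "x \<noteq> 0"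
  shows "1 \<le> norm x"
  using assms by (fastforce simp: admissible_def unit_disc_eq_ball)

text \<open>Differences of lattice points are lattice points, so an admissible lattice has pairwise
  distances at least \<open>1\<close>.\<close>

lemma admissible_unit_disc_finite:
  assumes "admissible unit_disc \<Lambda>"
  shows "finite (\<Lambda> \<inter> cball 0 r)"
proof -
  obtain g where g: "\<Lambda> = lattice_of g"
    using assms by (auto simp: admissible_def lattices_def)
  have "uniform_discrete \<Lambda>"
    unfolding uniform_discrete_def
  proof (intro exI conjI ballI impI)
    fix x y assume "x \<in> \<Lambda>" "y \<in> \<Lambda>" "dist x y < 1"
    then show "x = y"
      using admissible_unit_disc_norm_ge[OF assms, of "x - y"] lattice_of_diff[of x g y] g
      by (force simp: dist_norm)
  qed simp
  then show ?thesis
    by (metis bounded_Int bounded_cball inf_le1 uniform_discrete_finite_iff uniform_discrete_subset)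
qed

text \<open>Gauss reduction. The vector \<open>a\<close> is chosen shortest among the first vectors of all bases,
  instead of among all nonzero lattice vectors, so that it is part of a basis from the start. The other
  vector is then translated by a multiple of \<open>a\<close> to make its component along \<open>a\<close> small; exchanging
  the two vectors shows that it cannot have become shorter than \<open>a\<close>.\<close>

lemma reduced_basis_exists:
  assumes adm: "admissible unit_disc \<Lambda>"
  obtains a b where "frame a b \<in> GL2" "\<Lambda> = lattice_of (frame a b)"
    "norm a \<le> norm b" "\<bar>a \<bullet> b\<bar> \<le> (a \<bullet> a) / 2"
proof -
  define N where "N = {a. \<exists>b. frame a b \<in> GL2 \<and> \<Lambda> = lattice_of (frame a b)}"
  obtain g where g: "g \<in> GL2" "\<Lambda> = lattice_of g"
    using adm by (auto simp: admissible_def lattices_def)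
  then have a0: "column 1 g \<in> N"
    unfolding N_def using frame_columns[of g] by (metis (mono_tags, lifting) mem_Collect_eq)
  have "N \<subseteq> \<Lambda>"
  proof
    fix a assume "a \<in> N"
    then obtain b where "\<Lambda> = lattice_of (frame a b)" by (auto simp: N_def)
    then show "a \<in> \<Lambda>"
      by (simp add: mem_lattice_of_frame)
  qed
  define M where "M = N \<inter> cball 0 (norm (column 1 g))"
  have "finite M" "M \<noteq> {}"
    using admissible_unit_disc_finite[OF adm] \<open>N \<subseteq> \<Lambda>\<close> a0
    by (auto simp: M_def intro: finite_subset[rotated])
  then obtain a where a: "a \<in> M" "\<And>x. x \<in> M \<Longrightarrow> norm a \<le> norm x"
    using ex_min_if_finite[of "norm ` M"] by (metis arg_min_if_finite(1) arg_min_least)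
  have amin: "norm a \<le> norm x" if "x \<in> N" for x
    using a that by (cases "norm x \<le> norm (column 1 g)") (auto simp: M_def)
  obtain b where b: "frame a b \<in> GL2" "\<Lambda> = lattice_of (frame a b)"
    using a(1) by (auto simp: M_def N_def)
  define n where "n = round ((a \<bullet> b) / (a \<bullet> a))"
  define b' where "b' = b - of_int n *\<^sub>R a"
  have 1: "frame a b' \<in> GL2" "lattice_of (frame a b') = \<Lambda>"
    using change_of_basis[of 1 1 0 "-n" a b a b'] b by (auto simp: b'_def)
  have "frame b' a \<in> GL2" "lattice_of (frame b' a) = \<Lambda>"
    using change_of_basis[of 0 0 1 1 a b' b' a] 1 by auto
  then have "b' \<in> N" by (auto simp: N_def)
  then have 2: "norm a \<le> norm b'" by (rule amin)
  have "a \<noteq> 0"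
    using b(1) by (auto simp: frame_in_GL2_iff det_frame)
  then have pos: "a \<bullet> a > 0" by simp
  have "a \<bullet> b' = (a \<bullet> a) * ((a \<bullet> b) / (a \<bullet> a) - of_int n)"
    using pos by (simp add: b'_def inner_diff_right field_simps)
  moreover have "\<bar>(a \<bullet> b) / (a \<bullet> a) - of_int n\<bar> \<le> 1 / 2"
    unfolding n_def using of_int_round_abs_le by (metis abs_minus_commute)
  ultimately have "\<bar>a \<bullet> b'\<bar> \<le> (a \<bullet> a) * (1 / 2)"
    using pos by (simp only: abs_mult abs_of_pos mult_left_mono less_imp_le)
  then show thesis
    using that[of a b'] 1 2 by simp
qed

section \<open>Hexagonal lattices\<close>

definition rot60 :: "real^2 \<Rightarrow> real^2" where
  "rot60 w = vector [w $ 1 / 2 - sqrt 3 / 2 * w $ 2, sqrt 3 / 2 * w $ 1 + w $ 2 / 2]"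

definition hex_lattice :: "real^2 \<Rightarrow> (real^2) set" where
  "hex_lattice w = lattice_of (frame w (rot60 w))"

lemma rot60_inner:
  "rot60 w \<bullet> rot60 w = w \<bullet> w" "w \<bullet> rot60 w = (w \<bullet> w) / 2"
  by (simp_all add: rot60_def inner_real2 field_simps power2_eq_square)

lemma norm_rot60: "norm (rot60 w) = norm w"
  by (simp add: norm_eq_sqrt_inner rot60_inner)

lemma det_hex: "det (frame w (rot60 w)) = sqrt 3 / 2 * (w \<bullet> w)"
  by (simp add: det_frame rot60_def inner_real2 field_simps)

lemma hex_frame_GL2: "w \<noteq> 0 \<Longrightarrow> frame w (rot60 w) \<in> GL2"
  by (simp add: frame_in_GL2_iff det_hex)

text \<open>The norm form \<open>x\<^sup>2 + x y + y\<^sup>2\<close> of the Eisenstein integers. It takes integer values at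
  integers, which separates the unit vectors of the lattice from all longer ones.\<close>

lemma inner_hex_combination:
  "(x *\<^sub>R w + y *\<^sub>R rot60 w) \<bullet> (x *\<^sub>R w + y *\<^sub>R rot60 w) = (x\<^sup>2 + x * y + y\<^sup>2) * (w \<bullet> w)"
  by (simp add: inner_add_left inner_add_right rot60_inner inner_commute[of "rot60 w" w]
      power2_eq_square algebra_simps)

text \<open>Rotation \<open>R\<close> by \<open>60\<close> degrees satisfies \<open>R\<^sup>2 = R - 1\<close>.\<close>

lemma rot60_hex_combination:
  "rot60 (x *\<^sub>R w + y *\<^sub>R rot60 w) = (- y) *\<^sub>R w + (x + y) *\<^sub>R rot60 w"
proof -
  have [simp]: "sqrt 3 * (sqrt 3 * z) = 3 * z" for z
    by (simp flip: mult.assoc)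
  show ?thesis
    by (simp add: rot60_def vec_eq_iff forall_2 field_simps)
qed

lemma hex_lattice_norm_squared:
  assumes "norm w = 1" "v \<in> hex_lattice w"
  obtains m n :: int where "v = of_int m *\<^sub>R w + of_int n *\<^sub>R rot60 w"
    "v \<bullet> v = of_int (m\<^sup>2 + m * n + n\<^sup>2)"
proof -
  obtain m n :: int where v: "v = of_int m *\<^sub>R w + of_int n *\<^sub>R rot60 w"
    using assms(2) by (auto simp: hex_lattice_def lattice_of_frame)
  moreover have "v \<bullet> v = of_int (m\<^sup>2 + m * n + n\<^sup>2)"
    using assms(1) by (simp add: v inner_hex_combination norm_eq_1)
  ultimately show thesis by (rule that)
qed

text \<open>If \<open>v = m w + n R w\<close>, then \<open>R v = - n w + (m + n) R w\<close>, and the determinant of this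
  substitution is \<open>m\<^sup>2 + m n + n\<^sup>2\<close>, the squared length of \<open>v\<close>. A unit vector of the lattice thus
  generates the whole lattice together with its rotation.\<close>

lemma hex_lattice_eqI:
  assumes "norm w = 1" "v \<in> hex_lattice w" "norm v = 1"
  shows "hex_lattice v = hex_lattice w"
proof -
  obtain m n :: int where v: "v = of_int m *\<^sub>R w + of_int n *\<^sub>R rot60 w"
    "v \<bullet> v = of_int (m\<^sup>2 + m * n + n\<^sup>2)"
    using assms hex_lattice_norm_squared by blast
  then have "m\<^sup>2 + m * n + n\<^sup>2 = 1"
    using assms(3) by (metis norm_eq_1 of_int_eq_1_iff)
  then have "\<bar>m * (m + n) - n * (- n)\<bar> = 1"
    by (simp add: power2_eq_square algebra_simps)
  moreover have "rot60 v = of_int (- n) *\<^sub>R w + of_int (m + n) *\<^sub>R rot60 w"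
    by (simp add: v(1) rot60_hex_combination)
  moreover have "frame w (rot60 w) \<in> GL2"
    using assms(1) by (intro hex_frame_GL2) auto
  ultimately show ?thesis
    unfolding hex_lattice_def using change_of_basis(2) v(1) by blast
qed

lemma hex_lattice_contains:
  "w \<in> hex_lattice w" "rot60 w \<in> hex_lattice w" "- w \<in> hex_lattice w"
  "rot60 w - w \<in> hex_lattice w" "0 \<in> hex_lattice w"
proof -
  have *: "of_int m *\<^sub>R w + of_int n *\<^sub>R rot60 w \<in> hex_lattice w" for m n
    by (auto simp: hex_lattice_def lattice_of_frame)
  show "w \<in> hex_lattice w" "rot60 w \<in> hex_lattice w" "- w \<in> hex_lattice w"
    "rot60 w - w \<in> hex_lattice w" "0 \<in> hex_lattice w"
    using *[of 1 0] *[of 0 1] *[of "-1" 0] *[of "-1" 1] *[of 0 0] by simp_all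
qed

lemma hex_lattice_in_lattices: "norm w = 1 \<Longrightarrow> hex_lattice w \<in> lattices"
  unfolding lattices_def hex_lattice_def by (intro imageI hex_frame_GL2) auto

lemma covolume_hex_lattice:
  assumes "norm w = 1"
  shows "covolume (hex_lattice w) = sqrt 3 / 2"
proof -
  have "frame w (rot60 w) \<in> GL2"
    using assms by (intro hex_frame_GL2) auto
  then show ?thesis
    using assms by (simp add: hex_lattice_def covolume_lattice_of det_hex norm_eq_1)
qed

lemma hex_lattice_norm_ge:
  assumes "norm w = 1" "v \<in> hex_lattice w" "v \<noteq> 0"
  shows "norm v = 1 \<or> v \<bullet> v \<ge> 2"
proof -
  obtain k :: int where k: "v \<bullet> v = of_int k"
    using assms hex_lattice_norm_squared by metis
  have "v \<bullet> v > 0" using assms(3) by simp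
  then have "k = 1 \<or> k \<ge> 2" using k by simp linarith
  then show ?thesis using k by (auto simp: norm_eq_1)
qed

lemma hex_lattice_admissible_unit_disc:
  assumes "norm w = 1"
  shows "admissible unit_disc (hex_lattice w)"
proof -
  have "norm v \<ge> 1" if "v \<in> hex_lattice w" "v \<noteq> 0" for v
    using hex_lattice_norm_ge[OF assms that] by (auto simp: norm_eq_sqrt_inner)
  then show ?thesis
    using hex_lattice_in_lattices[OF assms] hex_lattice_contains(5)
    by (fastforce simp: admissible_def unit_disc_eq_ball)
qed

text \<open>In the plane there are only two unit vectors at angle \<open>60\<close> degrees to \<open>a\<close>; the signed area
  \<open>t\<close> of the pair tells them apart.\<close>

lemma hex_pair:
  assumes "norm a = 1" "norm b = 1" "a \<bullet> b = 1 / 2"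
  shows "b = rot60 a \<or> a = rot60 b"
proof -
  define t where "t = a $ 1 * b $ 2 - b $ 1 * a $ 2"
  have aa: "a $ 1 * a $ 1 + a $ 2 * a $ 2 = 1" and bb: "b $ 1 * b $ 1 + b $ 2 * b $ 2 = 1"
    and ab: "a $ 1 * b $ 1 + a $ 2 * b $ 2 = 1 / 2"
    using assms by (simp_all add: norm_eq_1 inner_real2)
  have "t\<^sup>2 = (a \<bullet> a) * (b \<bullet> b) - (a \<bullet> b)\<^sup>2"
    using det_frame_squared[of a b] by (simp add: det_frame t_def)
  also have "\<dots> = (sqrt 3 / 2)\<^sup>2"
    unfolding assms(3) using assms(1,2) by (simp add: norm_eq_1 power_divide)
  finally have "t = sqrt 3 / 2 \<or> t = - (sqrt 3 / 2)"
    by (simp only: power2_eq_iff)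
  then show ?thesis
  proof
    assume t: "t = sqrt 3 / 2"
    have "b $ 1 = (1 / 2) * a $ 1 - t * a $ 2" "b $ 2 = t * a $ 1 + (1 / 2) * a $ 2"
      using aa ab unfolding t_def by algebra+
    then have "b = rot60 a"
      by (simp add: rot60_def vec_eq_iff forall_2 t)
    then show ?thesis ..
  next
    assume t: "t = - (sqrt 3 / 2)"
    have "a $ 1 = (1 / 2) * b $ 1 + t * b $ 2" "a $ 2 = (1 / 2) * b $ 2 - t * b $ 1"
      using bb ab unfolding t_def by algebra+
    then have "a = rot60 b"
      by (simp add: rot60_def vec_eq_iff forall_2 t)
    then show ?thesis ..
  qed
qed

section \<open>Critical lattices of the disc and of larger sets\<close>

text \<open>For a reduced basis, the Gram determinant is at least
  \<open>\<bar>a\<bar>\<^sup>2 \<bar>b\<bar>\<^sup>2 - \<bar>a\<bar>\<^sup>4 / 4 \<ge> 3 \<bar>a\<bar>\<^sup>4 / 4 \<ge> 3 / 4\<close>. Equality forces two unit vectors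
  at angle \<open>60\<close> or \<open>120\<close> degrees, and the second case reduces to the first by a sign change.\<close>

lemma covolume_admissible_unit_disc:
  assumes adm: "admissible unit_disc \<Lambda>"
  shows "covolume \<Lambda> \<ge> sqrt 3 / 2"
    and "covolume \<Lambda> = sqrt 3 / 2 \<Longrightarrow> \<exists>w. norm w = 1 \<and> \<Lambda> = hex_lattice w"
proof -
  obtain a b where ab: "frame a b \<in> GL2" "\<Lambda> = lattice_of (frame a b)"
    "norm a \<le> norm b" "\<bar>a \<bullet> b\<bar> \<le> (a \<bullet> a) / 2"
    using reduced_basis_exists[OF adm] by blast
  define A B c where "A = a \<bullet> a" and "B = b \<bullet> b" and "c = a \<bullet> b"
  have "a \<noteq> 0"
    using ab(1) by (auto simp: frame_in_GL2_iff det_frame)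
  have "a \<in> \<Lambda>"
    by (simp add: ab(2) mem_lattice_of_frame)
  then have "norm a \<ge> 1"
    using admissible_unit_disc_norm_ge[OF adm] \<open>a \<noteq> 0\<close> by blast
  then have A: "A \<ge> 1" and AB: "A \<le> B"
    using ab(3) by (auto simp: A_def B_def norm_eq_sqrt_inner)
  have "\<bar>c\<bar> \<le> A / 2" using ab(4) by (simp add: A_def c_def)
  then have c2: "c\<^sup>2 \<le> (A / 2)\<^sup>2" by (simp add: abs_le_square_iff[symmetric])
  have cov: "(covolume \<Lambda>)\<^sup>2 = A * B - c\<^sup>2"
    by (simp add: ab(2) covolume_lattice_of[OF ab(1)] det_frame_squared A_def B_def c_def)
  have cov0: "covolume \<Lambda> \<ge> 0"
    by (simp add: ab(2) covolume_lattice_of[OF ab(1)])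
  have A2: "A * A \<ge> 1" using A mult_mono[of 1 A 1 A] by simp
  have AB2: "A * A \<le> A * B" using A AB by (simp add: mult_left_mono)
  have quart: "(A / 2)\<^sup>2 = A * A / 4" by (simp add: power2_eq_square)
  have s3: "(sqrt 3 / 2)\<^sup>2 = 3 / 4" by (simp add: power_divide)
  have "(sqrt 3 / 2)\<^sup>2 \<le> (covolume \<Lambda>)\<^sup>2"
    unfolding cov s3 using c2 A2 AB2 quart by linarith
  then show "covolume \<Lambda> \<ge> sqrt 3 / 2"
    using cov0 power2_le_imp_le by blast
  assume "covolume \<Lambda> = sqrt 3 / 2"
  then have eq: "A * B - c\<^sup>2 = 3 / 4"
    by (metis cov s3)
  then have "A * A = 1" "A * B = 1" "c\<^sup>2 = 1 / 4"
    using c2 A2 AB2 quart by linarith+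
  then have "A = 1" using A by (simp add: square_eq_1_iff)
  then have "B = 1" using \<open>A * B = 1\<close> by simp
  have norms: "norm a = 1" "norm b = 1"
    using \<open>A = 1\<close> \<open>B = 1\<close> by (simp_all add: A_def B_def norm_eq_1)
  have "c\<^sup>2 = (1 / 2)\<^sup>2" using \<open>c\<^sup>2 = 1 / 4\<close> by (simp add: power_divide)
  then have "c = 1 / 2 \<or> c = - (1 / 2)" by (simp only: power2_eq_iff)
  then obtain b' where b': "frame a b' \<in> GL2" "\<Lambda> = lattice_of (frame a b')"
    "norm b' = 1" "a \<bullet> b' = 1 / 2"
  proof
    assume "c = 1 / 2"
    then show thesis using that[of b] ab norms by (simp add: c_def)
  next
    assume "c = - (1 / 2)"
    then show thesis
      using that[of "- b"] change_of_basis[of 1 "-1" 0 0 a b a "- b"] ab norms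
      by (simp add: c_def)
  qed
  have swap: "\<Lambda> = lattice_of (frame b' a)"
    using change_of_basis(2)[of 0 0 1 1 a b' b' a] b' by simp
  show "\<exists>w. norm w = 1 \<and> \<Lambda> = hex_lattice w"
    using hex_pair[OF norms(1) b'(3,4)] b' norms swap by (auto simp: hex_lattice_def)
qed

text \<open>Enlarging the disc can only remove admissible lattices. As long as one hexagonal lattice
  survives, the minimal covolume stays the same and is attained by the surviving hexagonal lattices
  only.\<close>

lemma critical_det_disc_superset:
  assumes sub: "unit_disc \<subseteq> K" and w: "norm w = 1" "admissible K (hex_lattice w)"
  shows "critical_det K = sqrt 3 / 2"
    and "critical_locus K = {\<Lambda>. \<exists>w. norm w = 1 \<and> \<Lambda> = hex_lattice w \<and> admissible K \<Lambda>}"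
proof -
  have adm: "admissible unit_disc \<Lambda>" if "admissible K \<Lambda>" for \<Lambda>
  proof -
    have "0 \<in> unit_disc" by (simp add: unit_disc_def)
    then show ?thesis
      using that sub unfolding admissible_def by blast
  qed
  show det: "critical_det K = sqrt 3 / 2"
    unfolding critical_det_def
  proof (rule cInf_eq_minimum)
    show "sqrt 3 / 2 \<in> {covolume \<Lambda> |\<Lambda>. admissible K \<Lambda>}"
      using w covolume_hex_lattice by force
  qed (use adm covolume_admissible_unit_disc(1) in blast)
  show "critical_locus K = {\<Lambda>. \<exists>w. norm w = 1 \<and> \<Lambda> = hex_lattice w \<and> admissible K \<Lambda>}"
    unfolding critical_locus_def critical_def det
    using adm covolume_admissible_unit_disc(2) covolume_hex_lattice by blast
qed

lemma critical_locus_unit_disc: "critical_locus unit_disc = hex_lattice ` sphere 0 1"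
proof -
  have e: "norm (axis 1 1 :: real^2) = 1" by simp
  show ?thesis
    using critical_det_disc_superset(2)[OF order_refl e hex_lattice_admissible_unit_disc[OF e]]
      hex_lattice_admissible_unit_disc by auto
qed

text \<open>The map factors through matrices: the basis depends continuously on \<open>w\<close>, and passing from a
  matrix to its lattice is the quotient map that defines the topology.\<close>

lemma continuous_map_hex_lattice:
  "continuous_map (top_of_set (sphere 0 1)) (subtopology lattice_space (critical_locus unit_disc))
     hex_lattice"
proof -
  have "continuous_on (sphere 0 1) (\<lambda>w. frame w (rot60 w))"
  proof -
    have "continuous_on (sphere 0 1) (\<lambda>w. frame w (rot60 w) $ i $ j)" for i j
      using exhaust_2[of i] exhaust_2[of j]
      by (elim disjE) (simp_all add: frame_def rot60_def, auto intro!: continuous_intros)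
    then have "continuous_on (sphere 0 1) (\<lambda>w. \<chi> i. \<chi> j. frame w (rot60 w) $ i $ j)"
      by (intro continuous_on_vec_lambda)
    then show ?thesis by simp
  qed
  moreover have "frame w (rot60 w) \<in> GL2" if "w \<in> sphere 0 1" for w
    using that by (intro hex_frame_GL2) auto
  ultimately have "continuous_map (top_of_set (sphere 0 1)) (top_of_set GL2) (\<lambda>w. frame w (rot60 w))"
    by (auto simp: image_subset_iff)
  then have "continuous_map (top_of_set (sphere 0 1)) lattice_space
      (lattice_of \<circ> (\<lambda>w. frame w (rot60 w)))"
    using quotient_map_lattice_of quotient_imp_continuous_map continuous_map_compose by blast
  moreover have "lattice_of \<circ> (\<lambda>w. frame w (rot60 w)) = hex_lattice"
    by (simp add: fun_eq_iff hex_lattice_def)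
  ultimately show ?thesis
    by (auto simp: continuous_map_in_subtopology critical_locus_unit_disc)
qed

lemma compact_directions:
  assumes "closedin (subtopology lattice_space (critical_locus unit_disc)) Z"
  shows "compact {w. norm w = 1 \<and> hex_lattice w \<in> Z}"
proof -
  have "closedin (top_of_set (sphere 0 1)) {w \<in> topspace (top_of_set (sphere 0 1)). hex_lattice w \<in> Z}"
    using continuous_map_hex_lattice assms by (rule closedin_continuous_map_preimage)
  then have "compact {w \<in> topspace (top_of_set (sphere 0 1)). hex_lattice w \<in> Z}"
    using closedin_compact compact_sphere by blast
  moreover have "{w \<in> topspace (top_of_set (sphere 0 1)). hex_lattice w \<in> Z} =
      {w. norm w = 1 \<and> hex_lattice w \<in> Z}"
    by auto
  ultimately show ?thesis by simp
qed

section \<open>Intersections of open half-planes\<close>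

definition open_polar :: "(real^2) set \<Rightarrow> (real^2) set" where
  "open_polar S = {x. \<forall>s\<in>S. x \<bullet> s < 1}"

text \<open>Compactness provides a direction \<open>t\<close> in which \<open>x\<close> is closest to violating its constraint,
  hence a common positive slack \<open>1 - x \<bullet> t\<close> for the infinitely many constraints.\<close>

lemma open_open_polar:
  assumes "compact S"
  shows "open (open_polar S)"
proof (cases "S = {}")
  case False
  show ?thesis
    unfolding open_contains_ball
  proof
    fix x assume x: "x \<in> open_polar S"
    have "\<exists>t\<in>S. \<forall>s\<in>S. x \<bullet> s \<le> x \<bullet> t"
      using assms False by (intro continuous_attains_sup continuous_intros)
    then obtain t where t: "t \<in> S" "\<And>s. s \<in> S \<Longrightarrow> x \<bullet> s \<le> x \<bullet> t" by blast
    obtain B where B: "B > 0" "\<And>s. s \<in> S \<Longrightarrow> norm s \<le> B"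
      using compact_imp_bounded[OF assms] bounded_pos by metis
    have "ball x ((1 - x \<bullet> t) / B) \<subseteq> open_polar S"
      unfolding open_polar_def
    proof clarify
      fix y s assume y: "y \<in> ball x ((1 - x \<bullet> t) / B)" and s: "s \<in> S"
      have "(y - x) \<bullet> s \<le> norm (y - x) * norm s" by (rule norm_cauchy_schwarz)
      also have "\<dots> \<le> norm (y - x) * B" using B(2)[OF s] by (simp add: mult_left_mono)
      also have "\<dots> < 1 - x \<bullet> t" using y B(1) by (simp add: dist_norm norm_minus_commute field_simps)
      finally show "y \<bullet> s < 1" using t(2)[OF s] by (simp add: inner_diff_left)
    qed
    moreover have "(1 - x \<bullet> t) / B > 0" using x t(1) B(1) by (auto simp: open_polar_def)
    ultimately show "\<exists>e>0. ball x e \<subseteq> open_polar S" by blast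
  qed
qed (simp add: open_polar_def)

lemma convex_open_polar: "convex (open_polar S)"
proof -
  have "open_polar S = (\<Inter>s\<in>S. {x. s \<bullet> x < 1})"
    by (auto simp: open_polar_def inner_commute)
  then show ?thesis by (simp add: convex_INT convex_halfspace_lt)
qed

text \<open>The equality case of the Cauchy-Schwarz inequality: the tangent line at \<open>s\<close> touches the disc
  in \<open>s\<close> alone.\<close>

lemma unit_inner_eq_1:
  fixes w s :: "'a::real_inner"
  assumes "norm w = 1" "norm s = 1" "w \<bullet> s \<ge> 1"
  shows "w = s"
proof -
  have "(w - s) \<bullet> (w - s) = 2 - 2 * (w \<bullet> s)"
    using assms by (simp add: inner_diff_left inner_diff_right norm_eq_1 inner_commute)
  then have "(w - s) \<bullet> (w - s) = 0"
    using assms(3) inner_ge_zero[of "w - s"] by linarith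
  then show ?thesis by simp
qed

text \<open>The three strips bound a regular hexagon with inradius \<open>1\<close>. Two strips alone give a rhombus
  that reaches out to distance \<open>2\<close>, beyond the second shortest vectors of the hexagonal lattice.\<close>

lemma hexagon_inner_less:
  assumes w: "norm w = 1"
    and p: "\<bar>x \<bullet> w\<bar> < 1" and q: "\<bar>x \<bullet> rot60 w\<bar> < 1" and pq: "\<bar>x \<bullet> (rot60 w - w)\<bar> < 1"
  shows "x \<bullet> x < 4 / 3"
proof -
  define p q where "p = x \<bullet> w" and "q = x \<bullet> rot60 w"
  have 1: "w $ 1 * w $ 1 + w $ 2 * w $ 2 = 1"
    using w by (simp add: norm_eq_1 inner_real2)
  \<comment> \<open>The component of \<open>x\<close> along \<open>w\<close> rotated by a right angle.\<close>
  define t where "t = x $ 2 * w $ 1 - x $ 1 * w $ 2"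
  have "q = p / 2 + sqrt 3 / 2 * t"
    by (simp add: p_def q_def t_def inner_real2 rot60_def field_simps)
  then have "(2 * q - p)\<^sup>2 = (sqrt 3 * t)\<^sup>2"
    by simp
  then have "4 * (p\<^sup>2 - p * q + q\<^sup>2) = 3 * (p\<^sup>2 + t\<^sup>2)"
    unfolding power_mult_distrib by (simp add: power2_eq_square algebra_simps)
  also have "p\<^sup>2 + t\<^sup>2 = x \<bullet> x"
    unfolding p_def t_def inner_real2 using 1 by algebra
  finally have "3 * (x \<bullet> x) = 4 * (p\<^sup>2 - p * q + q\<^sup>2)" ..
  moreover have "p\<^sup>2 - p * q + q\<^sup>2 < 1"
  proof -
    have sq: "p\<^sup>2 < 1" "q\<^sup>2 < 1" "(q - p)\<^sup>2 < 1"
      using assms by (simp_all add: p_def q_def inner_diff_right abs_square_less_1)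
    have diff: "(q - p)\<^sup>2 = p\<^sup>2 - 2 * (p * q) + q\<^sup>2"
      by (simp add: power2_eq_square algebra_simps)
    consider "p * q \<le> 0" | "0 \<le> p * q" "\<bar>p\<bar> \<le> \<bar>q\<bar>" | "0 \<le> p * q" "\<bar>q\<bar> \<le> \<bar>p\<bar>" by linarith
    then show ?thesis
    proof cases
      case 1
      then show ?thesis using sq diff by linarith
    next
      case 2
      then have "\<bar>p\<bar> * \<bar>p\<bar> \<le> \<bar>p\<bar> * \<bar>q\<bar>" by (intro mult_left_mono) auto
      then have "p\<^sup>2 \<le> p * q" using 2 by (simp add: power2_eq_square flip: abs_mult)
      then show ?thesis using sq by linarith
    next
      case 3
      then have "\<bar>q\<bar> * \<bar>q\<bar> \<le> \<bar>p\<bar> * \<bar>q\<bar>" by (intro mult_right_mono) auto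
      then have "q\<^sup>2 \<le> p * q" using 3 by (simp add: power2_eq_square flip: abs_mult)
      then show ?thesis using sq by linarith
    qed
  qed
  ultimately have "3 * (x \<bullet> x) < 4" by simp
  then show ?thesis by simp
qed

section \<open>Closed sets of hexagonal lattices as critical loci\<close>

theorem theorem1p3:
  fixes Z :: "(real^2) set set"
  assumes "closedin (subtopology lattice_space (critical_locus unit_disc)) Z"
    and "Z \<noteq> {}"
  shows "\<exists>K. planar_domain K \<and> bounded K \<and> convex K \<and> symmetric_set K \<and>
             unit_disc \<subseteq> K \<and> critical_locus K = Z"
proof -
  define S where "S = {w. norm w = 1 \<and> hex_lattice w \<in> Z}"
  define K where "K = open_polar S"
  have "Z \<subseteq> critical_locus unit_disc"
    using closedin_subset[OF assms(1)] by simp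
  then have Z: "\<exists>w\<in>S. \<Lambda> = hex_lattice w" if "\<Lambda> \<in> Z" for \<Lambda>
    using that unfolding S_def critical_locus_unit_disc by fastforce
  then obtain w0 where w0: "w0 \<in> S" using assms(2) by blast
  have S_lattice: "v \<in> S" if "w \<in> S" "v \<in> hex_lattice w" "norm v = 1" for v w
    using that hex_lattice_eqI[of w v] by (auto simp: S_def)
  have S_neg: "- w \<in> S" if "w \<in> S" for w
    using S_lattice[OF that hex_lattice_contains(3)] that by (simp add: S_def)
  have K_abs: "\<bar>x \<bullet> s\<bar> < 1" if "x \<in> K" "s \<in> S" for x s
    using that S_neg[OF that(2)] by (force simp: K_def open_polar_def abs_less_iff)
  have K_small: "x \<bullet> x < 4 / 3" if "x \<in> K" for x
  proof -
    have n: "norm w0 = 1" using w0 by (simp add: S_def)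
    have "norm (rot60 w0 - w0) = 1"
      using inner_hex_combination[of "-1" w0 1] n by (simp add: norm_eq_1)
    then have "rot60 w0 \<in> S" "rot60 w0 - w0 \<in> S"
      using S_lattice[OF w0] hex_lattice_contains norm_rot60[of w0] n by auto
    then show ?thesis
      using hexagon_inner_less[OF n] K_abs[OF that] w0 by blast
  qed
  have disc: "unit_disc \<subseteq> K"
  proof
    fix x assume "x \<in> unit_disc"
    then have "x \<bullet> s < 1" if "s \<in> S" for s
      using that norm_cauchy_schwarz[of x s] by (simp add: S_def unit_disc_eq_ball)
    then show "x \<in> K" by (simp add: K_def open_polar_def)
  qed
  have adm: "admissible K (hex_lattice w)" if "w \<in> S" for w
  proof -
    have n: "norm w = 1" using that by (simp add: S_def)
    have "v = 0" if v: "v \<in> hex_lattice w" "v \<in> K" for v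
    proof (rule ccontr)
      assume "v \<noteq> 0"
      then have "norm v = 1"
        using hex_lattice_norm_ge[OF n v(1)] K_small[OF v(2)] by linarith
      moreover from this have "v \<in> S" using S_lattice \<open>w \<in> S\<close> v(1) by blast
      ultimately show False
        using v(2) K_abs[OF v(2), of v] by (simp add: norm_eq_1)
    qed
    then show ?thesis
      using hex_lattice_in_lattices[OF n] hex_lattice_contains(5) disc
      by (auto simp: admissible_def unit_disc_def)
  qed
  have mem: "w \<in> S" if w: "norm w = 1" "admissible K (hex_lattice w)" for w
  proof -
    have "w \<noteq> 0" using w(1) by auto
    then have "w \<notin> K"
      using w(2) hex_lattice_contains(1)[of w] unfolding admissible_def by blast
    then obtain s where "s \<in> S" "w \<bullet> s \<ge> 1"
      by (auto simp: K_def open_polar_def not_less)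
    then show ?thesis
      using unit_inner_eq_1[of w s] w(1) by (simp add: S_def)
  qed
  have "norm w0 = 1" using w0 by (simp add: S_def)
  then have "critical_locus K = Z"
    unfolding critical_det_disc_superset(2)[OF disc \<open>norm w0 = 1\<close> adm[OF w0]]
    using Z adm mem by (auto simp: S_def; blast)
  moreover have "open K"
    unfolding K_def S_def by (intro open_open_polar compact_directions assms)
  moreover have "convex K" by (simp add: K_def convex_open_polar)
  moreover have "bounded K"
  proof -
    have "norm x \<le> 2" if "x \<in> K" for x
      using K_small[OF that] by (auto simp: norm_eq_sqrt_inner intro!: real_le_lsqrt)
    then show ?thesis by (auto simp: bounded_iff)
  qed
  moreover have "symmetric_set K"
  proof -
    have "- x \<in> K" if "x \<in> K" for x
      using that S_neg by (force simp: K_def open_polar_def)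
    then show ?thesis
      unfolding symmetric_set_def by (force simp: image_iff)
  qed
  moreover have "0 \<in> K" using disc by (auto simp: unit_disc_def)
  ultimately show ?thesis
    using disc convex_connected by (auto simp: planar_domain_def)
qed

end
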